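(* Let $F$ be a real $d\times d$ matrix with $J=\det F>0$, let $V^2=FF^t$, and let $S$ be a non-singular symmetric $d\times d$ matrix. Put $K=J$ and $\rho=J\,S\,V^{-2}S$ (the local material parameters of the cloak). Let $n\in\mathbb R^d$ be a unit vector. Then, for plane waves with phase direction $n$ in the pentamode material with modulus $K$, tensor $S$ and inertia tensor $\rho$, the non-zero phase speed $v>0$, the wave (energy flux) velocity $c$, and the polarization $q$ (not normalized, i.e. up to a non-zero scalar factor) are given by $$v^2=n\cdot V^2 n,\qquad c=v^{-1}V^2 n,\qquad q=S^{-1}c .$$ In particular, the phase speed and the wave velocity depend only on the deformation gradient $F$, and not on the choice of $S$.
   Context: Plane waves: in a uniform pentamode material with stiffness $K\,S\otimes S$ and symmetric inertia tensor $\rho$, a displacement $u(x,t)=q\,e^{ik(n\cdot x-vt)}$ with $|n|=1$ and constant $q\neq0$ satisfies the equations of motion if and only if $$\big(K\,(Sn)\otimes(Sn)-\rho\,v^2\big)q=0 .$$ The phase speed is the $v>0$ for which this has a non-trivial solution $q$, and $q$ is the polarization. The wave (energy flux) velocity of this wave is $c=v^{-1}K\,S\rho^{-1}S\,n$. Here $(a\otimes b)q=(b\cdot q)\,a$, and $V$ is the positive definite symmetric square root of $FF^t$. *)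

theory Defs
  imports "HOL-Analysis.Analysis"
begin

definition dyad :: "real ^ 'd \<Rightarrow> real ^ 'd \<Rightarrow> real ^ 'd ^ 'd" where
  "dyad a b = (\<chi> i j. a $ i * b $ j)"

lemma dyad_mult_vec: "dyad a b *v q = (b \<bullet> q) *\<^sub>R a"
  by (simp add: vec_eq_iff dyad_def matrix_vector_mult_def inner_vec_def
      sum_distrib_left mult_ac)

definition symmetric_matrix :: "real ^ 'd ^ 'd \<Rightarrow> bool" where
  "symmetric_matrix A \<longleftrightarrow> transpose A = A"

definition positive_definite :: "real ^ 'd ^ 'd \<Rightarrow> bool" where
  "positive_definite A \<longleftrightarrow> (\<forall>x. x \<noteq> 0 \<longrightarrow> x \<bullet> (A *v x) > 0)"

definition left_stretch :: "real ^ 'd ^ 'd \<Rightarrow> real ^ 'd ^ 'd \<Rightarrow> bool" where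
  "left_stretch F V \<longleftrightarrow>
     symmetric_matrix V \<and> positive_definite V \<and> V ** V = F ** transpose F"

text \<open>The displacement \<open>q exp (i k (n \<bullet> x - v t))\<close>, with \<open>q\<close> a constant non-zero vector,
  satisfies the equations of motion of the uniform pentamode material with stiffness
  \<open>K S \<otimes> S\<close> and inertia tensor \<open>\<rho>\<close> exactly when the following (Christoffel)
  equation holds; \<open>q\<close> is then a polarization for the speed \<open>v\<close>.\<close>

definition polarization ::
  "real \<Rightarrow> real ^ 'd ^ 'd \<Rightarrow> real ^ 'd ^ 'd \<Rightarrow> real ^ 'd \<Rightarrow> real \<Rightarrow> real ^ 'd \<Rightarrow> bool" where
  "polarization K S \<rho> n v q \<longleftrightarrow>
     q \<noteq> 0 \<and> (K *\<^sub>R dyad (S *v n) (S *v n) - v\<^sup>2 *\<^sub>R \<rho>) *v q = 0"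

definition phase_speed ::
  "real \<Rightarrow> real ^ 'd ^ 'd \<Rightarrow> real ^ 'd ^ 'd \<Rightarrow> real ^ 'd \<Rightarrow> real \<Rightarrow> bool" where
  "phase_speed K S \<rho> n v \<longleftrightarrow> v > 0 \<and> (\<exists>q. polarization K S \<rho> n v q)"

text \<open>Energy flux velocity of a plane wave with phase direction \<open>n\<close> and phase speed \<open>v\<close>.\<close>

definition wave_velocity ::
  "real \<Rightarrow> real ^ 'd ^ 'd \<Rightarrow> real ^ 'd ^ 'd \<Rightarrow> real ^ 'd \<Rightarrow> real \<Rightarrow> real ^ 'd" where
  "wave_velocity K S \<rho> n v = (inverse v * K) *\<^sub>R (S *v (matrix_inv \<rho> *v (S *v n)))"

definition cloak_modulus :: "real ^ 'd ^ 'd \<Rightarrow> real" where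
  "cloak_modulus F = det F"

definition cloak_inertia ::
  "real ^ 'd ^ 'd \<Rightarrow> real ^ 'd ^ 'd \<Rightarrow> real ^ 'd ^ 'd \<Rightarrow> real ^ 'd ^ 'd" where
  "cloak_inertia F V S = det F *\<^sub>R (S ** matrix_inv (V ** V) ** S)"

end

(* Writing B = F F^T and p = S q, cancelling K S and multiplying by B turns the Christoffel
   equation into the rank-one eigenvalue problem (n . p) B n = v^2 p. For v > 0 it forces p to be
   parallel to B n and v^2 = n . B n = |F^T n|^2 > 0. The tensor S has disappeared from it. *)

theory Submission
  imports Defs
begin

lemma symmetric_matrix_inner:
  assumes "symmetric_matrix A"
  shows "(A *v x) \<bullet> y = x \<bullet> (A *v y)"
  using assms by (metis dot_lmul_matrix symmetric_matrix_def transpose_matrix_vector)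

text \<open>\<open>matrix_inv\<close> picks a two-sided inverse by Hilbert choice, so invertibility
  is what makes the chosen matrix satisfy both equations.\<close>

lemma matrix_inv_mult:
  assumes "invertible A"
  shows "A ** matrix_inv A = mat 1" and "matrix_inv A ** A = mat 1"
  using someI_ex[OF assms[unfolded invertible_def]] unfolding matrix_inv_def by auto

lemma matrix_inv_mult_vec:
  fixes A :: "real ^ 'n ^ 'n"
  assumes "invertible A"
  shows "matrix_inv A *v (A *v x) = x" and "A *v (matrix_inv A *v x) = x"
  using matrix_inv_mult[OF assms] by (simp_all add: matrix_vector_mul_assoc)

lemma matrix_inv_mult_vec_eq_iff:
  fixes A :: "real ^ 'n ^ 'n"
  assumes "invertible A"
  shows "matrix_inv A *v y = x \<longleftrightarrow> y = A *v x"
  using matrix_inv_mult_vec[OF assms] by metis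

lemma invertible_mult_vec_eq_0_iff:
  fixes A :: "real ^ 'n ^ 'n"
  assumes "invertible A"
  shows "A *v x = 0 \<longleftrightarrow> x = 0"
  using matrix_inv_mult_vec(1)[OF assms] by (metis matrix_vector_mult_0_right)

lemma invertible_matrix_inv:
  fixes A :: "real ^ 'n ^ 'n"
  assumes "invertible A"
  shows "invertible (matrix_inv A)"
  using matrix_inv_mult[OF assms] invertible_def by blast

text \<open>Because the same \<open>K\<close> scales both stiffness and inertia, the Christoffel
  matrix applied to \<open>q\<close> factors as \<open>K\<close> times \<open>S\<close> times a
  residual vector. Since \<open>K\<close> is non-zero and \<open>S\<close> and \<open>B\<close> are
  injective, it vanishes exactly when \<open>B\<close> times the residual does.\<close>

lemma polarization_iff:
  fixes S B :: "real ^ 'd ^ 'd"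
  assumes S: "symmetric_matrix S" "invertible S" and B: "invertible B" and K: "K \<noteq> 0"
  shows "polarization K S (K *\<^sub>R (S ** matrix_inv B ** S)) n v q \<longleftrightarrow>
    q \<noteq> 0 \<and> (n \<bullet> (S *v q)) *\<^sub>R (B *v n) = v\<^sup>2 *\<^sub>R (S *v q)"
proof -
  let ?a = "n \<bullet> (S *v q)"
  let ?\<rho> = "K *\<^sub>R (S ** matrix_inv B ** S)"
  \<comment> \<open>The residual left after taking \<open>K\<close> and \<open>S\<close> out on the
    left. Symmetry of \<open>S\<close> turns the dyad's coefficient (S n) . q into n . (S
    q).\<close>
  let ?r = "?a *\<^sub>R n - v\<^sup>2 *\<^sub>R (matrix_inv B *v (S *v q))"
  have "(K *\<^sub>R dyad (S *v n) (S *v n) - v\<^sup>2 *\<^sub>R ?\<rho>) *v q = K *\<^sub>R (S *v ?r)"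
    by (simp add: matrix_vector_mult_diff_rdistrib scaleR_matrix_vector_assoc[symmetric]
        dyad_mult_vec symmetric_matrix_inner[OF S(1)] matrix_vector_mul_assoc[symmetric]
        matrix_vector_mult_diff_distrib matrix_vector_mult_scaleR scaleR_diff_right)
  moreover have "B *v ?r = ?a *\<^sub>R (B *v n) - v\<^sup>2 *\<^sub>R (S *v q)"
    by (simp add: matrix_vector_mult_diff_distrib matrix_vector_mult_scaleR
        matrix_inv_mult_vec[OF B])
  ultimately have "(K *\<^sub>R dyad (S *v n) (S *v n) - v\<^sup>2 *\<^sub>R ?\<rho>) *v q = 0 \<longleftrightarrow>
      ?a *\<^sub>R (B *v n) - v\<^sup>2 *\<^sub>R (S *v q) = 0"
    using K invertible_mult_vec_eq_0_iff[OF S(2)] invertible_mult_vec_eq_0_iff[OF B]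
    by (metis scaleR_eq_0_iff)
  then show ?thesis
    unfolding polarization_def by simp
qed

text \<open>With \<open>v > 0\<close> the eigenvalue equation can be divided by v^2, so
  \<open>S *v q\<close> lies on the line spanned by \<open>B *v n\<close>; pairing with
  \<open>n\<close> then fixes v^2. At v = 0 every \<open>q\<close> with n . (S q) = 0 would solve
  the equation instead.\<close>

lemma polarization_iff_parallel:
  fixes S B :: "real ^ 'd ^ 'd"
  assumes S: "symmetric_matrix S" "invertible S" and B: "invertible B" and K: "K \<noteq> 0"
    and v: "v > 0"
  shows "polarization K S (K *\<^sub>R (S ** matrix_inv B ** S)) n v q \<longleftrightarrow>
    v\<^sup>2 = n \<bullet> (B *v n) \<and> (\<exists>a. a \<noteq> 0 \<and> q = a *\<^sub>R (matrix_inv S *v (B *v n)))"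
    (is "?P \<longleftrightarrow> ?R")
proof
  assume ?P
  then have q: "q \<noteq> 0" and eq: "(n \<bullet> (S *v q)) *\<^sub>R (B *v n) = v\<^sup>2 *\<^sub>R (S *v q)"
    using polarization_iff[OF S B K] by auto
  define a where "a = (n \<bullet> (S *v q)) / v\<^sup>2"
  have Sq: "S *v q = a *\<^sub>R (B *v n)"
    using arg_cong[OF eq, of "\<lambda>x. inverse (v\<^sup>2) *\<^sub>R x"] v
    by (simp add: a_def divide_inverse_commute)
  moreover have "S *v q \<noteq> 0"
    using q invertible_mult_vec_eq_0_iff[OF S(2)] by blast
  ultimately have a: "a \<noteq> 0"
    by auto
  \<comment> \<open>The number n . (S q) is evaluated twice, by the definition of \<open>a\<close>
    and through \<open>Sq\<close>; cancelling \<open>a\<close> leaves the speed.\<close>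
  have "a * v\<^sup>2 = n \<bullet> (S *v q)"
    using v by (simp add: a_def)
  also have "\<dots> = a * (n \<bullet> (B *v n))"
    by (simp add: Sq)
  finally have "v\<^sup>2 = n \<bullet> (B *v n)"
    using a by simp
  moreover have "q = a *\<^sub>R (matrix_inv S *v (B *v n))"
    using Sq matrix_inv_mult_vec(1)[OF S(2), of q] by (simp add: matrix_vector_mult_scaleR)
  ultimately show ?R
    using a by blast
next
  assume ?R
  then obtain a where vv: "v\<^sup>2 = n \<bullet> (B *v n)" and a: "a \<noteq> 0"
    and q: "q = a *\<^sub>R (matrix_inv S *v (B *v n))"
    by blast
  have Sq: "S *v q = a *\<^sub>R (B *v n)"
    by (simp add: q matrix_vector_mult_scaleR matrix_inv_mult_vec[OF S(2)])
  \<comment> \<open>If \<open>B *v n\<close> were zero, then \<open>vv\<close> would give v^2 =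
    0.\<close>
  have "B *v n \<noteq> 0"
    using vv v by auto
  then have "q \<noteq> 0"
    using Sq a by auto
  then show ?P
    using polarization_iff[OF S B K] by (simp add: Sq vv mult.commute)
qed

text \<open>Once v^2 has the right value, the factor a = 1 already supplies a polarization.\<close>

lemma phase_speed_iff:
  fixes S B :: "real ^ 'd ^ 'd"
  assumes "symmetric_matrix S" "invertible S" "invertible B" "K \<noteq> 0"
  shows "phase_speed K S (K *\<^sub>R (S ** matrix_inv B ** S)) n v \<longleftrightarrow>
    v > 0 \<and> v\<^sup>2 = n \<bullet> (B *v n)"
  unfolding phase_speed_def using polarization_iff_parallel[OF assms]
  by (metis zero_neq_one)

text \<open>The inverse of the inertia tensor is K^-1 S^-1 B S^-1, so the outer factors
  \<open>S\<close> and the modulus \<open>K\<close> cancel in the energy flux formula.\<close>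

lemma wave_velocity_eq:
  fixes S B :: "real ^ 'd ^ 'd"
  assumes S: "invertible S" and B: "invertible B" and K: "K \<noteq> 0"
  shows "wave_velocity K S (K *\<^sub>R (S ** matrix_inv B ** S)) n v = inverse v *\<^sub>R (B *v n)"
proof -
  let ?\<rho> = "K *\<^sub>R (S ** matrix_inv B ** S)"
  \<comment> \<open>The expected value of the inverse inertia tensor at \<open>S *v n\<close>; it is
    confirmed by applying the tensor to it, without computing the inverse matrix.\<close>
  let ?y = "inverse K *\<^sub>R (matrix_inv S *v (B *v n))"
  have "invertible ?\<rho>"
    by (intro scalar_invertible invertible_mult invertible_matrix_inv S B K)
  moreover have "S *v n = ?\<rho> *v ?y"
    using K by (simp add: scaleR_matrix_vector_assoc[symmetric] matrix_vector_mult_scaleR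
        matrix_vector_mul_assoc[symmetric] matrix_inv_mult_vec[OF S] matrix_inv_mult_vec[OF B])
  ultimately have "matrix_inv ?\<rho> *v (S *v n) = ?y"
    by (simp add: matrix_inv_mult_vec_eq_iff)
  then show ?thesis
    using K by (simp add: wave_velocity_def matrix_vector_mult_scaleR matrix_inv_mult_vec[OF S])
qed

theorem mainTheorem5:
  fixes F V S \<rho> :: "real ^ 'd ^ 'd" and n :: "real ^ 'd" and K :: real
  assumes "det F > 0"
    and "left_stretch F V"
    and "symmetric_matrix S" and "invertible S"
    and "K = cloak_modulus F" and "\<rho> = cloak_inertia F V S"
    and "norm n = 1"
  shows "(\<exists>!v. phase_speed K S \<rho> n v) \<and>
    (\<forall>v. phase_speed K S \<rho> n v \<longrightarrow>
       v\<^sup>2 = n \<bullet> ((V ** V) *v n) \<and>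
       wave_velocity K S \<rho> n v = inverse v *\<^sub>R ((V ** V) *v n) \<and>
       (\<forall>q. polarization K S \<rho> n v q \<longleftrightarrow>
          (\<exists>a. a \<noteq> 0 \<and> q = a *\<^sub>R (matrix_inv S *v wave_velocity K S \<rho> n v)))) \<and>
    (\<forall>V' S'. left_stretch F V' \<and> symmetric_matrix S' \<and> invertible S' \<longrightarrow>
       (\<forall>v. phase_speed K S' (cloak_inertia F V' S') n v \<longleftrightarrow> phase_speed K S \<rho> n v) \<and>
       (\<forall>v. phase_speed K S \<rho> n v \<longrightarrow>
          wave_velocity K S' (cloak_inertia F V' S') n v = wave_velocity K S \<rho> n v))"
proof -
  define B where "B = F ** transpose F"
  have detF: "det F \<noteq> 0"
    using assms(1) by simp
  then have B: "invertible B"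
    by (simp add: B_def invertible_det_nz det_mul)
  \<comment> \<open>Every left stretch of \<open>F\<close> has the same square \<open>B\<close>. The
    facts below are stated for arbitrary \<open>W\<close> and \<open>T\<close> so that they serve
    both the given pair \<open>V\<close>, \<open>S\<close> and the competing pair \<open>V'\<close>,
    \<open>S'\<close>.\<close>
  have VV: "W ** W = B" if "left_stretch F W" for W
    using that by (simp add: left_stretch_def B_def)
  have \<rho>: "cloak_inertia F W T = det F *\<^sub>R (T ** matrix_inv B ** T)"
    if "left_stretch F W" for W T
    using VV[OF that] by (simp add: cloak_inertia_def)
  have speed: "phase_speed K T (cloak_inertia F W T) n v \<longleftrightarrow> v > 0 \<and> v\<^sup>2 = n \<bullet> (B *v n)"
    if "left_stretch F W" "symmetric_matrix T" "invertible T" for W T v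
    using phase_speed_iff[OF that(2,3) B detF] assms(5)
    by (simp add: \<rho>[OF that(1)] cloak_modulus_def)
  have vel: "wave_velocity K T (cloak_inertia F W T) n v = inverse v *\<^sub>R (B *v n)"
    if "left_stretch F W" "invertible T" for W T v
    using wave_velocity_eq[OF that(2) B detF] assms(5)
    by (simp add: \<rho>[OF that(1)] cloak_modulus_def)
  note S = assms(2,3,4)
  \<comment> \<open>Existence of a positive speed rests on n . B n = |F^T n|^2, which is positive
    because F^T is injective and \<open>n\<close> is a unit vector.\<close>
  have "n \<noteq> 0"
    using assms(7) by auto
  then have "transpose F *v n \<noteq> 0"
    using invertible_mult_vec_eq_0_iff[of "transpose F"] detF
    by (simp add: invertible_det_nz)
  moreover have "n \<bullet> (B *v n) = (transpose F *v n) \<bullet> (transpose F *v n)"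
    by (simp add: B_def matrix_vector_mul_assoc[symmetric] dot_lmul_matrix[symmetric])
  ultimately have pos: "n \<bullet> (B *v n) > 0"
    by simp
  have ex1: "\<exists>!v. phase_speed K S \<rho> n v"
    unfolding assms(6) speed[OF S]
  proof (rule ex1I)
    show "sqrt (n \<bullet> (B *v n)) > 0 \<and> (sqrt (n \<bullet> (B *v n)))\<^sup>2 = n \<bullet> (B *v n)"
      using pos by simp
  next
    fix v assume "v > 0 \<and> v\<^sup>2 = n \<bullet> (B *v n)"
    then show "v = sqrt (n \<bullet> (B *v n))"
      by (metis real_sqrt_unique less_imp_le)
  qed
  have pol: "polarization K S \<rho> n v q \<longleftrightarrow>
      (\<exists>a. a \<noteq> 0 \<and> q = a *\<^sub>R (matrix_inv S *v (inverse v *\<^sub>R (B *v n))))"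
    (is "_ \<longleftrightarrow> ?R") if "phase_speed K S \<rho> n v" for v q
  proof -
    have v: "v > 0" "v\<^sup>2 = n \<bullet> (B *v n)"
      using that speed[OF S] assms(6) by auto
    let ?u = "matrix_inv S *v (B *v n)"
    have "polarization K S \<rho> n v q \<longleftrightarrow> (\<exists>a. a \<noteq> 0 \<and> q = a *\<^sub>R ?u)"
      using polarization_iff_parallel[OF assms(3,4) B detF v(1)] v(2) assms(5,6)
      by (simp add: \<rho>[OF assms(2)] cloak_modulus_def)
    \<comment> \<open>The wave velocity carries an extra factor 1/v; replacing \<open>a\<close> by
      \<open>a * v\<close> absorbs it, and the factor stays non-zero.\<close>
    also have "\<dots> \<longleftrightarrow> (\<exists>a. a \<noteq> 0 \<and> q = (a * inverse v) *\<^sub>R ?u)"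
    proof
      assume "\<exists>a. a \<noteq> 0 \<and> q = a *\<^sub>R ?u"
      then obtain a where "a \<noteq> 0" "q = a *\<^sub>R ?u"
        by blast
      then show "\<exists>a. a \<noteq> 0 \<and> q = (a * inverse v) *\<^sub>R ?u"
        using v(1) by (intro exI[of _ "a * v"]) simp
    next
      assume "\<exists>a. a \<noteq> 0 \<and> q = (a * inverse v) *\<^sub>R ?u"
      then show "\<exists>a. a \<noteq> 0 \<and> q = a *\<^sub>R ?u"
        using v(1) by (metis inverse_nonzero_iff_nonzero less_irrefl mult_eq_0_iff)
    qed
    finally show ?thesis
      by (simp add: matrix_vector_mult_scaleR)
  qed
  have "\<forall>v. phase_speed K S \<rho> n v \<longrightarrow>
       v\<^sup>2 = n \<bullet> ((V ** V) *v n) \<and>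
       wave_velocity K S \<rho> n v = inverse v *\<^sub>R ((V ** V) *v n) \<and>
       (\<forall>q. polarization K S \<rho> n v q \<longleftrightarrow>
          (\<exists>a. a \<noteq> 0 \<and> q = a *\<^sub>R (matrix_inv S *v wave_velocity K S \<rho> n v)))"
    using speed[OF S] vel[OF S(1,3)] pol VV[OF assms(2)] assms(6) by simp
  moreover have "\<forall>V' S'. left_stretch F V' \<and> symmetric_matrix S' \<and> invertible S' \<longrightarrow>
       (\<forall>v. phase_speed K S' (cloak_inertia F V' S') n v \<longleftrightarrow> phase_speed K S \<rho> n v) \<and>
       (\<forall>v. phase_speed K S \<rho> n v \<longrightarrow>
          wave_velocity K S' (cloak_inertia F V' S') n v = wave_velocity K S \<rho> n v)"
    \<comment> \<open>Both materials yield the same expressions in \<open>B\<close>,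
      \<open>n\<close> and \<open>v\<close>, in which neither stretch nor tensor occurs.\<close>
    using speed vel S assms(6) by simp
  ultimately show ?thesis
    using ex1 by blast
qed

end
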